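(* Let $X$ be an irreducible and positive recurrent Markov chain on $\mathbb{Z}_+=\{0,1,2,\dots\}$ with transition matrix $P=(P(x,y):x,y\in\mathbb{Z}_+)$ and unique stationary distribution $\pi$. Suppose that $X$ is stochastically monotone, and let $A_n=\{0,1,\dots,n\}$ for $n\ge 1$. Then, for any sequence $(P_n:n\ge 1)$ such that $P_n$ is a general augmentation of $P$ on $A_n$ for each $n$, and for any choice of $\pi_n\in\Pi_n$, $$\sum_{x\in\mathbb{Z}_+}|\pi_n(x)-\pi(x)|\to 0\qquad\text{as } n\to\infty .$$
   Context: A Markov chain on $\mathbb{Z}_+$ with transition matrix $P$ is stochastically monotone if for each $y\in\mathbb{Z}_+$ the quantity $\sum_{w\ge y}P(x,w)$ is non-decreasing in $x$. A general augmentation of (the truncation to $A_n$ of) $P$ is a stochastic matrix $P_n=(P_n(x,y):x,y\in A_n)$ on $A_n$ such that $P_n(x,y)\ge P(x,y)$ for all $x,y\in A_n$. $\Pi_n$ denotes the set of all stationary distributions of $P_n$ on $A_n$, i.e. probability vectors $\pi_n$ on $A_n$ with $\pi_nP_n=\pi_n$. Such a $\pi_n$ is regarded as a probability on $\mathbb{Z}_+$ by setting $\pi_n(x)=0$ for $x\notin A_n$. *)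

theory Defs
  imports "HOL-Probability.Probability"
begin

text \<open>A matrix indexed by \<open>S\<close> is a function of two arguments in the ambient type, of which
  only the values on \<open>S \<times> S\<close> are relevant.\<close>

definition stochastic_matrix :: "'s set \<Rightarrow> ('s \<Rightarrow> 's \<Rightarrow> real) \<Rightarrow> bool" where
  "stochastic_matrix S P \<longleftrightarrow>
     (\<forall>x\<in>S. \<forall>y\<in>S. 0 \<le> P x y) \<and> (\<forall>x\<in>S. (P x has_sum 1) S)"

text \<open>The process \<open>X\<close> is a Markov chain with transition matrix \<open>P\<close> started in \<open>x\<close> under
  \<open>Pr x\<close>, for every state \<open>x\<close>. The Markov property is stated in product form, so that no
  conditioning on null events occurs.\<close>

definition markov_chain ::
  "('s \<Rightarrow> 's \<Rightarrow> real) \<Rightarrow> ('s \<Rightarrow> 'w measure) \<Rightarrow> (nat \<Rightarrow> 'w \<Rightarrow> 's) \<Rightarrow> bool" where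
  "markov_chain P Pr X \<longleftrightarrow>
     stochastic_matrix UNIV P \<and>
     (\<forall>x. prob_space (Pr x) \<and>
       (\<forall>n. X n \<in> measurable (Pr x) (count_space UNIV)) \<and>
       (AE \<omega> in Pr x. X 0 \<omega> = x) \<and>
       (\<forall>n s y. \<P>(\<omega> in Pr x. (\<forall>i\<le>n. X i \<omega> = s i) \<and> X (Suc n) \<omega> = y) =
          \<P>(\<omega> in Pr x. \<forall>i\<le>n. X i \<omega> = s i) * P (s n) y))"

primrec n_step :: "('s \<Rightarrow> 's \<Rightarrow> real) \<Rightarrow> nat \<Rightarrow> 's \<Rightarrow> 's \<Rightarrow> real" where
  "n_step P 0 x y = (if x = y then 1 else 0)"
| "n_step P (Suc n) x y = (\<Sum>\<^sub>\<infinity>z. P x z * n_step P n z y)"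

definition irreducible_matrix :: "('s \<Rightarrow> 's \<Rightarrow> real) \<Rightarrow> bool" where
  "irreducible_matrix P \<longleftrightarrow> (\<forall>x y. \<exists>n. n_step P n x y > 0)"

text \<open>The infimum of the empty set is \<open>\<infinity>\<close>, the return time of a path that never returns.\<close>

definition return_time :: "(nat \<Rightarrow> 'w \<Rightarrow> 's) \<Rightarrow> 's \<Rightarrow> 'w \<Rightarrow> ennreal" where
  "return_time X x \<omega> = (INF n\<in>{n. 1 \<le> n \<and> X n \<omega> = x}. of_nat n)"

definition positive_recurrent ::
  "('s \<Rightarrow> 'w measure) \<Rightarrow> (nat \<Rightarrow> 'w \<Rightarrow> 's) \<Rightarrow> bool" where
  "positive_recurrent Pr X \<longleftrightarrow> (\<forall>x. (\<integral>\<^sup>+ \<omega>. return_time X x \<omega> \<partial>Pr x) < \<infinity>)"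

definition stochastically_monotone :: "(nat \<Rightarrow> nat \<Rightarrow> real) \<Rightarrow> bool" where
  "stochastically_monotone P \<longleftrightarrow> (\<forall>y. mono (\<lambda>x. \<Sum>\<^sub>\<infinity>w\<in>{y..}. P x w))"

text \<open>Stationary distributions on \<open>S\<close>, extended by zero to the whole type.\<close>

definition stationary_distributions :: "'s set \<Rightarrow> ('s \<Rightarrow> 's \<Rightarrow> real) \<Rightarrow> ('s \<Rightarrow> real) set" where
  "stationary_distributions S P =
     {\<nu>. (\<forall>x\<in>S. 0 \<le> \<nu> x) \<and> (\<forall>x. x \<notin> S \<longrightarrow> \<nu> x = 0) \<and> (\<nu> has_sum 1) S \<and>
         (\<forall>y\<in>S. ((\<lambda>x. \<nu> x * P x y) has_sum \<nu> y) S)}"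

definition general_augmentation ::
  "'s set \<Rightarrow> ('s \<Rightarrow> 's \<Rightarrow> real) \<Rightarrow> ('s \<Rightarrow> 's \<Rightarrow> real) \<Rightarrow> bool" where
  "general_augmentation A P Q \<longleftrightarrow>
     stochastic_matrix A Q \<and> (\<forall>x\<in>A. \<forall>y\<in>A. Q x y \<ge> P x y)"

end

theory Submission imports Defs "HOL-Library.Diagonal_Subsequence" begin

text \<open>An augmentation only adds mass inside \<open>A\<^sub>n\<close>, so \<open>\<pi>\<^sub>n P \<le> \<pi>\<^sub>n\<close> pointwise on \<open>A\<^sub>n\<close>, and
  hence \<open>\<pi>\<^sub>n\<close> is stochastically below \<open>\<pi>\<^sub>n P\<close>. By monotonicity the vectors \<open>\<pi>\<^sub>n P^k\<close> increase
  stochastically in \<open>k\<close>; being dominated by a multiple of \<open>\<pi>\<close>, they converge to a stationary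
  distribution, that is to \<open>\<pi>\<close>, without any aperiodicity or ergodic theorem. So every \<open>\<pi>\<^sub>n\<close>
  is stochastically below \<open>\<pi>\<close> and the sequence is tight. A subsequential limit \<open>\<mu>\<close> is a
  probability with \<open>\<mu> P \<le> \<mu>\<close>; both sides have mass one, so \<open>\<mu>\<close> is stationary and equals \<open>\<pi>\<close>.
  Pointwise convergence upgrades to convergence of the sums by Scheffe's lemma.\<close>

section \<open>Interchange of sums and dominated convergence\<close>

text \<open>Tonelli's theorem: nonnegativity turns summable row sums into absolute summability on
  \<open>A \<times> B\<close>, where the order of summation is free. Column summability is stated
  separately because \<open>infsum\<close> defaults to 0.\<close>

lemma has_sum_fubini_nonneg:
  fixes f :: "'a \<Rightarrow> 'b \<Rightarrow> real"
  assumes nonneg: "\<And>x y. x \<in> A \<Longrightarrow> y \<in> B \<Longrightarrow> 0 \<le> f x y"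
    and row: "\<And>x. x \<in> A \<Longrightarrow> (f x has_sum r x) B"
    and total: "(r has_sum s) A"
  shows "y \<in> B \<Longrightarrow> (\<lambda>x. f x y) summable_on A"
    and "((\<lambda>y. \<Sum>\<^sub>\<infinity>x\<in>A. f x y) has_sum s) B"
proof -
  let ?F = "\<lambda>(x, y). f x y"
  have row_abs: "((\<lambda>y. norm (f x y)) has_sum r x) B" if "x \<in> A" for x
    using row[OF that] by (rule has_sum_cong[THEN iffD1, rotated]) (use nonneg that in auto)
  have r0: "norm (\<Sum>\<^sub>\<infinity>y\<in>B. norm (f x y)) = r x" if "x \<in> A" for x
    using infsumI[OF row_abs[OF that]] has_sum_nonneg[OF row[OF that]] nonneg that by auto
  have "(\<lambda>z. norm (?F z)) summable_on A \<times> B"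
    unfolding Infinite_Sum.abs_summable_on_Sigma_iff
  proof (intro conjI ballI)
    show "(\<lambda>y. norm (?F (x, y))) summable_on B" if "x \<in> A" for x
      using row_abs[OF that] by (auto simp: summable_on_def)
    show "(\<lambda>x. norm (\<Sum>\<^sub>\<infinity>y\<in>B. norm (?F (x, y)))) summable_on A"
      using total r0 by (auto simp: summable_on_def cong: has_sum_cong)
  qed
  then have summ: "?F summable_on A \<times> B"
    by (rule abs_summable_summable)
  have "(?F has_sum s) (A \<times> B)"
    by (rule has_sum_SigmaI[where g = r]) (use row total summ in auto)
  then have swapped: "((\<lambda>(y, x). f x y) has_sum s) (B \<times> A)"
    by (subst (asm) has_sum_swap) simp
  then have "(\<lambda>(y, x). f x y) summable_on B \<times> A"
    by (auto simp: summable_on_def)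
  then show col: "(\<lambda>x. f x y) summable_on A" if "y \<in> B" for y
    using that by (rule summable_on_SigmaD1)
  show "((\<lambda>y. \<Sum>\<^sub>\<infinity>x\<in>A. f x y) has_sum s) B"
    by (rule has_sum_SigmaD[OF swapped]) (use col in auto)
qed

text \<open>Dominated convergence for counting measure, obtained from Tannery's theorem for
  \<open>suminf\<close>.\<close>

lemma infsum_tendsto_dominated:
  fixes f :: "nat \<Rightarrow> nat \<Rightarrow> real"
  assumes lim: "\<And>x. (\<lambda>n. f n x) \<longlonglongrightarrow> g x"
    and bound: "\<And>n x. \<bar>f n x\<bar> \<le> h x"
    and h: "h summable_on UNIV"
  shows "g summable_on UNIV"
    and "(\<lambda>n. \<Sum>\<^sub>\<infinity>x. f n x) \<longlonglongrightarrow> (\<Sum>\<^sub>\<infinity>x. g x)"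
proof -
  have f: "f n summable_on UNIV" for n
    by (rule abs_summable_summable, rule summable_on_comparison_test[OF h]) (use bound in auto)
  have "\<bar>g x\<bar> \<le> h x" for x
    using tendsto_rabs[OF lim] by (rule LIMSEQ_le_const2) (use bound in auto)
  then show g: "g summable_on UNIV"
    by (intro abs_summable_summable[OF summable_on_comparison_test[OF h]]) auto
  have to_suminf: "infsum u UNIV = suminf u" if "u summable_on UNIV" for u :: "nat \<Rightarrow> real"
    using has_sum_imp_sums[OF has_sum_infsum[OF that]] by (simp add: sums_iff)
  have "summable h"
    using has_sum_imp_sums[OF has_sum_infsum[OF h]] by (simp add: sums_iff)
  moreover have "eventually (\<lambda>(k, n). norm (f n k) \<le> h k) (at_top \<times>\<^sub>F sequentially)"
    by (rule always_eventually) (use bound in auto)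
  ultimately have "(\<lambda>n. suminf (f n)) \<longlonglongrightarrow> suminf g"
    using tannerys_theorem[where a = "\<lambda>k n. f n k" and b = g and M = h and F = sequentially] lim
    by simp
  then show "(\<lambda>n. \<Sum>\<^sub>\<infinity>x. f n x) \<longlonglongrightarrow> (\<Sum>\<^sub>\<infinity>x. g x)"
    by (simp add: to_suminf f g)
qed

lemma has_sum_diff:
  fixes f g :: "'a \<Rightarrow> real"
  assumes "(f has_sum a) A" "(g has_sum b) A"
  shows "((\<lambda>x. f x - g x) has_sum (a - b)) A"
  using has_sum_add[OF assms(1), of "\<lambda>x. - g x" "- b"] assms(2) by (simp add: has_sum_uminus)

text \<open>With equal totals there is no room for a strict inequality anywhere. This later turns
  subinvariance into invariance.\<close>

lemma has_sum_le_imp_eq: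
  fixes f g :: "'a \<Rightarrow> real"
  assumes "(f has_sum s) UNIV" "(g has_sum s) UNIV" "\<And>x. f x \<le> g x"
  shows "f = g"
proof
  fix x
  show "f x = g x"
    using has_sum_strict_mono[OF assms(1,2,3), of x] assms(3)[of x] by force
qed

section \<open>Probability vectors, tails and the stochastic order\<close>

definition prob_vec :: "('s \<Rightarrow> real) \<Rightarrow> bool" where
  "prob_vec q \<longleftrightarrow> (\<forall>x. 0 \<le> q x) \<and> (q has_sum 1) UNIV"

text \<open>The row vector qP: the law after one step when the initial law is
  \<open>q\<close>.\<close>

definition push :: "('s \<Rightarrow> 's \<Rightarrow> real) \<Rightarrow> ('s \<Rightarrow> real) \<Rightarrow> 's \<Rightarrow> real" where
  "push P q y = (\<Sum>\<^sub>\<infinity>x. q x * P x y)"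

text \<open>Pointwise comparison of tails is the usual stochastic order.\<close>

definition tail :: "(nat \<Rightarrow> real) \<Rightarrow> nat \<Rightarrow> real" where
  "tail q y = (\<Sum>\<^sub>\<infinity>w\<in>{y..}. q w)"

lemma prob_vec_nonneg: "prob_vec q \<Longrightarrow> 0 \<le> q x"
  and prob_vec_has_sum: "prob_vec q \<Longrightarrow> (q has_sum 1) UNIV"
  and prob_vec_summable: "prob_vec q \<Longrightarrow> q summable_on A"
  using summable_on_subset[of q UNIV A] by (auto simp: prob_vec_def dest: has_sum_imp_summable)

lemma prob_vec_le_1:
  assumes "prob_vec q"
  shows "q x \<le> 1"
  using has_sum_mono2[of q "{x}" "q x" UNIV 1] assms
  by (simp add: prob_vec_def has_sum_finiteI)

lemma prob_vec_le_imp_eq: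
  assumes "prob_vec q" "prob_vec r" "\<And>x. q x \<le> r x"
  shows "q = r"
  using assms by (intro has_sum_le_imp_eq) (auto simp: prob_vec_def)

text \<open>The complement is a finite sum, so pointwise limits and, with reversed direction,
  pointwise inequalities carry over to tails.\<close>

lemma tail_eq_1_minus:
  assumes "prob_vec q"
  shows "tail q y = 1 - (\<Sum>w<y. q w)"
proof -
  have "(q has_sum (1 - (\<Sum>w<y. q w))) (UNIV - {..<y})"
    using prob_vec_has_sum[OF assms] by (intro has_sum_Diff) auto
  moreover have "UNIV - {..<y} = {y..}"
    by auto
  ultimately show ?thesis
    unfolding tail_def by (simp add: infsumI)
qed

lemma tail_nonneg: "prob_vec q \<Longrightarrow> 0 \<le> tail q y"
  unfolding tail_def by (simp add: infsum_nonneg prob_vec_nonneg)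

lemma tail_le_1: "prob_vec q \<Longrightarrow> tail q y \<le> 1"
  by (simp add: tail_eq_1_minus prob_vec_nonneg sum_nonneg)

lemma prob_vec_eq_tail_diff: "prob_vec q \<Longrightarrow> q y = tail q y - tail q (Suc y)"
  by (simp add: tail_eq_1_minus)

lemma tail_tendsto_0:
  assumes "prob_vec q"
  shows "tail q \<longlonglongrightarrow> 0"
proof -
  have "(\<lambda>y. \<Sum>w<y. q w) \<longlonglongrightarrow> 1"
    using has_sum_imp_sums[OF prob_vec_has_sum[OF assms]] by (simp add: sums_def)
  then have "(\<lambda>y. 1 - (\<Sum>w<y. q w)) \<longlonglongrightarrow> 1 - 1"
    by (intro tendsto_intros)
  then show ?thesis
    by (simp add: tail_eq_1_minus[OF assms, abs_def])
qed

text \<open>Each \<open>f x\<close> is the sum of the increments of \<open>f\<close> up to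
  \<open>x\<close>. Exchanging the sums weights the increment at \<open>j\<close> by the mass of all
  \<open>x \<ge> j\<close>.\<close>

lemma abel_summation:
  fixes f :: "nat \<Rightarrow> real"
  assumes q: "prob_vec q" and f: "mono f" "\<And>x. 0 \<le> f x" "\<And>x. f x \<le> 1"
  shows "((\<lambda>j. (f j - (if j = 0 then 0 else f (j - 1))) * tail q j) has_sum (\<Sum>\<^sub>\<infinity>x. q x * f x)) UNIV"
proof -
  \<comment> \<open>Without the case split, truncated subtraction would make the increment at 0
    vanish instead of being \<open>f 0\<close>.\<close>
  let ?d = "\<lambda>j. f j - (if j = 0 then 0 else f (j - 1))"
  let ?D = "\<lambda>x j. q x * (if j \<le> x then ?d j else 0)"
  have d: "0 \<le> ?d j" for j
    using f(2)[of j] monoD[OF f(1), of "j - 1" j] by auto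
  have tele: "(\<Sum>j\<le>x. ?d j) = f x" for x
    by (induction x) auto
  have row: "(?D x has_sum (q x * f x)) UNIV" for x
    by (intro has_sum_cmult_right has_sum_finite_neutralI[of "{..x}"])
      (use tele[of x] in \<open>auto intro!: sum.cong\<close>)
  have "(\<lambda>x. q x * f x) summable_on UNIV"
    using prob_vec_summable[OF q]
    by (rule summable_on_comparison_test) (use prob_vec_nonneg[OF q] f in \<open>auto simp: mult_left_le\<close>)
  then have "((\<lambda>x. q x * f x) has_sum (\<Sum>\<^sub>\<infinity>x. q x * f x)) UNIV"
    by simp
  then have "((\<lambda>j. \<Sum>\<^sub>\<infinity>x. ?D x j) has_sum (\<Sum>\<^sub>\<infinity>x. q x * f x)) UNIV"
    by (intro has_sum_fubini_nonneg(2)[where f = ?D]) (use row d prob_vec_nonneg[OF q] in auto)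
  moreover have "(\<Sum>\<^sub>\<infinity>x. ?D x j) = ?d j * tail q j" for j
  proof -
    have "(\<Sum>\<^sub>\<infinity>x. ?D x j) = (\<Sum>\<^sub>\<infinity>x\<in>{j..}. ?d j * q x)"
      by (rule infsum_cong_neutral) auto
    then show ?thesis
      by (simp add: tail_def infsum_cmult_right')
  qed
  ultimately show ?thesis
    by simp
qed

text \<open>Abel summation writes both expectations as combinations of tails with the same
  nonnegative coefficients.\<close>

lemma expectation_mono_tail:
  fixes f :: "nat \<Rightarrow> real"
  assumes q: "prob_vec q" and r: "prob_vec r" and le: "\<And>y. tail q y \<le> tail r y"
    and f: "mono f" "\<And>x. 0 \<le> f x" "\<And>x. f x \<le> 1"
  shows "(\<Sum>\<^sub>\<infinity>x. q x * f x) \<le> (\<Sum>\<^sub>\<infinity>x. r x * f x)"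
proof (rule has_sum_mono[OF abel_summation[OF q f] abel_summation[OF r f]])
  fix j :: nat
  show "(f j - (if j = 0 then 0 else f (j - 1))) * tail q j
      \<le> (f j - (if j = 0 then 0 else f (j - 1))) * tail r j"
    using f(2)[of j] monoD[OF f(1), of "j - 1" j] by (intro mult_left_mono le) auto
qed

section \<open>Stochastic matrices acting on row vectors\<close>

locale stochastic_kernel =
  fixes P :: "'s \<Rightarrow> 's \<Rightarrow> real"
  assumes stochastic: "stochastic_matrix UNIV P"
begin

lemma row: "prob_vec (P x)"
  using stochastic by (auto simp: stochastic_matrix_def prob_vec_def)

text \<open>Tonelli again. Taking \<open>B\<close> to be everything gives conservation of mass, and
  \<open>{y..}\<close> gives the formula for tails; the second conclusion ensures that the sum
  defining \<open>push\<close> is never the default 0 of a divergent sum.\<close>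

lemma push_has_sum:
  assumes q: "\<And>x. 0 \<le> q x" "q summable_on UNIV"
  shows "(push P q has_sum (\<Sum>\<^sub>\<infinity>x. q x * (\<Sum>\<^sub>\<infinity>y\<in>B. P x y))) B"
    and "(\<lambda>x. q x * P x y) summable_on UNIV"
proof -
  have nonneg: "0 \<le> q x * P x y" for x y
    by (simp add: q prob_vec_nonneg[OF row])
  show "(\<lambda>x. q x * P x y) summable_on UNIV"
    by (rule summable_on_comparison_test[OF q(2)])
      (auto simp: nonneg mult_left_le q prob_vec_le_1[OF row])
  have "0 \<le> (\<Sum>\<^sub>\<infinity>y\<in>B. P x y)" "(\<Sum>\<^sub>\<infinity>y\<in>B. P x y) \<le> 1" for x
    using infsum_mono2[of "P x" B UNIV] prob_vec_summable[OF row[of x]]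
      infsumI[OF prob_vec_has_sum[OF row[of x]]]
    by (auto simp: prob_vec_nonneg[OF row] infsum_nonneg)
  then have "(\<lambda>x. q x * (\<Sum>\<^sub>\<infinity>y\<in>B. P x y)) summable_on UNIV"
    by (intro summable_on_comparison_test[OF q(2)]) (auto simp: mult_left_le q)
  then have total: "((\<lambda>x. q x * (\<Sum>\<^sub>\<infinity>y\<in>B. P x y)) has_sum (\<Sum>\<^sub>\<infinity>x. q x * (\<Sum>\<^sub>\<infinity>y\<in>B. P x y))) UNIV"
    by simp
  show "(push P q has_sum (\<Sum>\<^sub>\<infinity>x. q x * (\<Sum>\<^sub>\<infinity>y\<in>B. P x y))) B"
    unfolding push_def[abs_def]
    by (rule has_sum_fubini_nonneg(2)[OF _ _ total])
      (auto intro!: nonneg has_sum_cmult_right has_sum_infsum prob_vec_summable row)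
qed

text \<open>The mass \<open>s\<close> is arbitrary because the positive part of a difference, to
  which this is applied, need not have mass one.\<close>

lemma push_mass:
  assumes q: "\<And>x. 0 \<le> q x" "(q has_sum s) UNIV"
  shows "(push P q has_sum s) UNIV"
  using push_has_sum(1)[of q UNIV] q infsumI[OF prob_vec_has_sum[OF row]] infsumI[OF q(2)]
  by (auto simp: summable_on_def)

lemma push_nonneg: "(\<And>x. 0 \<le> q x) \<Longrightarrow> 0 \<le> push P q y"
  unfolding push_def by (simp add: infsum_nonneg prob_vec_nonneg[OF row])

lemma push_prob_vec: "prob_vec q \<Longrightarrow> prob_vec (push P q)"
  using push_mass[of q 1] push_nonneg[of q] by (auto simp: prob_vec_def)

lemma push_mono:
  assumes "\<And>x. 0 \<le> q x" "\<And>x. q x \<le> r x" "r summable_on UNIV"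
  shows "push P q y \<le> push P r y"
proof -
  have "q summable_on UNIV"
    using assms by (intro summable_on_comparison_test[OF assms(3)]) auto
  moreover have "0 \<le> r x" for x
    using assms(1,2) order_trans by blast
  ultimately show ?thesis
    unfolding push_def using assms
    by (intro infsum_mono push_has_sum mult_right_mono prob_vec_nonneg[OF row]) auto
qed

lemma stationary_iff:
  "q \<in> stationary_distributions UNIV P \<longleftrightarrow> prob_vec q \<and> push P q = q"
proof -
  have "((\<lambda>x. q x * P x y) has_sum q y) UNIV \<longleftrightarrow> push P q y = q y" if "prob_vec q" for y
    using push_has_sum(2)[of q y] that prob_vec_nonneg[OF that] prob_vec_summable[OF that]
    by (auto simp: push_def has_sum_iff)
  then show ?thesis
    by (auto simp: stationary_distributions_def prob_vec_def fun_eq_iff)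
qed

lemma n_step_nonneg: "0 \<le> n_step P n x y"
  by (induction n arbitrary: x) (auto intro!: infsum_nonneg mult_nonneg_nonneg prob_vec_nonneg[OF row])

text \<open>Induction on the path length: a positive n-step weight has a first step from
  \<open>x\<close> to some \<open>z\<close> of positive weight, and invariance gives
  \<open>q z\<close> at least the single term \<open>q x * P x z\<close>.\<close>

lemma invariant_pos_step:
  assumes q: "\<And>x. 0 \<le> q x" "q summable_on UNIV" "push P q = q"
    and "0 < q x" "0 < n_step P n x y"
  shows "0 < q y"
  using assms(4,5)
proof (induction n arbitrary: x)
  case 0
  then show ?case by (auto split: if_splits)
next
  case (Suc n)
  have "\<exists>z. P x z * n_step P n z y \<noteq> 0"
  proof (rule ccontr)
    assume "\<nexists>z. P x z * n_step P n z y \<noteq> 0"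
    then have "(\<Sum>\<^sub>\<infinity>z. P x z * n_step P n z y) = 0"
      by (intro infsum_0) auto
    then show False
      using Suc.prems(2) by simp
  qed
  then obtain z where "P x z * n_step P n z y \<noteq> 0" ..
  then have z: "0 < P x z" "0 < n_step P n z y"
    using prob_vec_nonneg[OF row, of x z] n_step_nonneg[of n z y] by (auto simp: less_le)
  have "(\<Sum>\<^sub>\<infinity>w\<in>{x}. q w * P w z) \<le> (\<Sum>\<^sub>\<infinity>w. q w * P w z)"
    by (rule infsum_mono2) (use push_has_sum(2)[OF q(1,2)] q(1) prob_vec_nonneg[OF row] in auto)
  also have "\<dots> = q z"
    using fun_cong[OF q(3), of z] by (simp add: push_def)
  finally have "q x * P x z \<le> q z"
    by simp
  then have "0 < q z"
    using mult_pos_pos[OF Suc.prems(1) z(1)] by linarith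
  then show ?case
    using Suc.IH z(2) by blast
qed

end

section \<open>Irreducibility: positivity and uniqueness of the stationary distribution\<close>

locale irreducible_kernel = stochastic_kernel +
  assumes irreducible: "irreducible_matrix P"
begin

lemma invariant_pos:
  assumes "\<And>x. 0 \<le> q x" "q summable_on UNIV" "push P q = q" "0 < q x"
  shows "0 < q y"
  using invariant_pos_step[OF assms] irreducible unfolding irreducible_matrix_def by blast

lemma stationary_pos:
  assumes "prob_vec q" "push P q = q"
  shows "0 < q y"
proof -
  have "\<exists>x. q x \<noteq> 0"
  proof (rule ccontr)
    assume "\<not> (\<exists>x. q x \<noteq> 0)"
    then have "(q has_sum 0) UNIV"
      by (intro has_sum_0) auto
    then show False
      using prob_vec_has_sum[OF assms(1)] has_sum_unique by fastforce
  qed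
  then obtain x where "0 < q x"
    using prob_vec_nonneg[OF assms(1)] by (metis less_le)
  then show ?thesis
    by (rule invariant_pos[OF prob_vec_nonneg[OF assms(1)] prob_vec_summable[OF assms(1)] assms(2)])
qed

lemma stationary_unique:
  assumes \<mu>: "prob_vec \<mu>" "push P \<mu> = \<mu>" and \<pi>: "prob_vec \<pi>" "push P \<pi> = \<pi>"
  shows "\<mu> = \<pi>"
proof -
  \<comment> \<open>The positive part of the difference is again invariant, so by irreducibility it is
    strictly positive everywhere or zero everywhere.\<close>
  define p where "p x = max 0 (\<mu> x - \<pi> x)" for x
  have p0: "0 \<le> p x" for x
    by (simp add: p_def)
  have "p x \<le> \<mu> x" for x
    using prob_vec_nonneg[OF \<mu>(1), of x] prob_vec_nonneg[OF \<pi>(1), of x] by (simp add: p_def)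
  then have ps: "p summable_on UNIV"
    using p0 by (intro summable_on_comparison_test[OF prob_vec_summable[OF \<mu>(1)]])
  \<comment> \<open>Invariance of both vectors bounds \<open>\<mu> y - \<pi> y\<close> by
    \<open>push P p y\<close>, which is also nonnegative and so bounds the positive part.\<close>
  have "p y \<le> push P p y" for y
  proof -
    have "\<mu> y = (\<Sum>\<^sub>\<infinity>x. \<mu> x * P x y)" "\<pi> y = (\<Sum>\<^sub>\<infinity>x. \<pi> x * P x y)"
      using fun_cong[OF \<mu>(2), of y] fun_cong[OF \<pi>(2), of y] by (simp_all add: push_def)
    moreover have summ: "(\<lambda>x. \<mu> x * P x y) summable_on UNIV" "(\<lambda>x. \<pi> x * P x y) summable_on UNIV"
      by (intro push_has_sum(2) prob_vec_nonneg prob_vec_summable \<mu>(1) \<pi>(1))+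
    ultimately have "\<mu> y - \<pi> y = (\<Sum>\<^sub>\<infinity>x. \<mu> x * P x y - \<pi> x * P x y)"
      using infsumI[OF has_sum_diff[OF has_sum_infsum[OF summ(1)] has_sum_infsum[OF summ(2)]]]
      by simp
    also have "\<dots> \<le> push P p y"
      unfolding push_def
    proof (rule infsum_mono)
      show "(\<lambda>x. \<mu> x * P x y - \<pi> x * P x y) summable_on UNIV"
        using has_sum_diff[OF has_sum_infsum[OF summ(1)] has_sum_infsum[OF summ(2)]]
        by (rule has_sum_imp_summable)
      show "(\<lambda>x. p x * P x y) summable_on UNIV"
        by (rule push_has_sum(2)[OF p0 ps])
      show "\<mu> x * P x y - \<pi> x * P x y \<le> p x * P x y" for x
        unfolding left_diff_distrib[symmetric] p_def
        by (intro mult_right_mono) (auto simp: prob_vec_nonneg[OF row])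
    qed
    finally show ?thesis
      using push_nonneg[of p y] p0 by (simp add: p_def)
  qed
  \<comment> \<open>Both sides have the same total mass, so the inequality is an equality.\<close>
  then have pinv: "push P p = p"
    by (rule has_sum_le_imp_eq[OF has_sum_infsum[OF ps] push_mass[OF p0 has_sum_infsum[OF ps]], symmetric])
  show ?thesis
  proof (cases "\<exists>x. 0 < p x")
    case True
    then have "0 < p y" for y
      using invariant_pos[OF p0 ps pinv] by blast
    \<comment> \<open>This case is in fact contradictory, but the weak inequality with equal masses
      already yields the goal.\<close>
    then have "\<pi> y \<le> \<mu> y" for y
      by (simp add: p_def less_max_iff_disj less_imp_le)
    then show ?thesis
      by (rule prob_vec_le_imp_eq[OF \<pi>(1) \<mu>(1), symmetric])
  next
    case False
    then have "\<mu> y \<le> \<pi> y" for y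
      by (simp add: p_def not_less)
    then show ?thesis
      by (rule prob_vec_le_imp_eq[OF \<mu>(1) \<pi>(1)])
  qed
qed

end

section \<open>Compactness by diagonal extraction\<close>

text \<open>Every coordinate stays in [0,1], so a diagonal subsequence converges in all of them. The
  limit may have lost mass; tightness has to exclude this later.\<close>

lemma prob_vec_subseq_tendsto:
  fixes q :: "nat \<Rightarrow> nat \<Rightarrow> real"
  assumes "\<And>n. prob_vec (q n)"
  obtains r \<mu> where "strict_mono (r :: nat \<Rightarrow> nat)" "\<And>x. (\<lambda>n. q (r n) x) \<longlonglongrightarrow> \<mu> x"
proof -
  interpret subseqs "\<lambda>x s. convergent (\<lambda>n. q (s n) x)"
  proof
    fix x and s :: "nat \<Rightarrow> nat"
    have "bounded (range (\<lambda>n. q (s n) x))"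
      using prob_vec_nonneg[OF assms] prob_vec_le_1[OF assms]
      by (intro boundedI[of _ 1]) auto
    then obtain l r where "strict_mono r" "((\<lambda>n. q (s n) x) \<circ> r) \<longlonglongrightarrow> l"
      using bounded_imp_convergent_subsequence by blast
    then show "\<exists>r'. strict_mono r' \<and> convergent (\<lambda>n. q ((s \<circ> r') n) x)"
      by (auto simp: convergent_def o_def)
  qed
  have "convergent (\<lambda>n. q (diagseq n) x)" for x
  proof -
    \<comment> \<open>Only from index \<open>Suc x\<close> on is the diagonal known to be a
      subsequence of the one chosen for coordinate \<open>x\<close>.\<close>
    have "convergent (\<lambda>n. q ((diagseq \<circ> (+) (Suc x)) n) x)"
    proof (rule diagseq_holds)
      fix r s :: "nat \<Rightarrow> nat" and n
      assume "strict_mono r" "convergent (\<lambda>k. q (s k) n)"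
      then show "convergent (\<lambda>k. q ((s \<circ> r) k) n)"
        using convergent_subseq_convergent[of "\<lambda>k. q (s k) n" r] by (simp add: o_def)
    qed
    then have "convergent (\<lambda>n. q (diagseq (n + Suc x)) x)"
      by (simp add: o_def add.commute)
    then show ?thesis
      by (rule convergent_ignore_initial_segment[THEN iffD1, of "\<lambda>n. q (diagseq n) x"])
  qed
  then show thesis
    using subseq_diagseq by (intro that[of diagseq "\<lambda>x. lim (\<lambda>n. q (diagseq n) x)"])
      (auto simp: convergent_LIMSEQ_iff)
qed

section \<open>Monotone kernels and stochastic domination by \<pi>\<close>

locale monotone_kernel = irreducible_kernel P for P :: "nat \<Rightarrow> nat \<Rightarrow> real" +
  fixes \<pi> :: "nat \<Rightarrow> real"
  assumes monotone: "stochastically_monotone P"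
    and \<pi>: "prob_vec \<pi>" "push P \<pi> = \<pi>"
begin

lemma tail_push: "prob_vec q \<Longrightarrow> tail (push P q) y = (\<Sum>\<^sub>\<infinity>x. q x * tail (P x) y)"
  unfolding tail_def
  using push_has_sum(1)[of q "{y..}"] by (simp add: infsumI prob_vec_nonneg prob_vec_summable)

text \<open>A tail of \<open>push P q\<close> is the expectation under \<open>q\<close> of
  \<open>tail (P x) y\<close>, which stochastic monotonicity makes non-decreasing in
  \<open>x\<close>.\<close>

lemma push_tail_mono:
  assumes "prob_vec q" "prob_vec r" "\<And>y. tail q y \<le> tail r y"
  shows "tail (push P q) y \<le> tail (push P r) y"
  unfolding tail_push[OF assms(1)] tail_push[OF assms(2)]
proof (rule expectation_mono_tail[OF assms])
  show "mono (\<lambda>x. tail (P x) y)"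
    using monotone by (simp add: stochastically_monotone_def tail_def)
qed (auto simp: tail_nonneg tail_le_1 row)

text \<open>Finite support puts a vector below a multiple of \<open>\<pi>\<close>, and iterating \<open>push P\<close> keeps it
  there; so the tails, which increase along the iteration, cannot lose mass in the limit.\<close>

lemma tail_le_stationary:
  assumes m: "prob_vec m" and supp: "finite {x. m x \<noteq> 0}"
    and incr: "\<And>y. tail m y \<le> tail (push P m) y"
  shows "tail m y \<le> tail \<pi> y"
proof -
  define q where "q k = (push P ^^ k) m" for k
  have q_0: "q 0 = m" and q_Suc: "q (Suc k) = push P (q k)" for k
    by (simp_all add: q_def)
  have q: "prob_vec (q k)" for k
    by (induction k) (auto simp: q_0 q_Suc m push_prob_vec)
  \<comment> \<open>A finite sum of nonnegative ratios, hence an upper bound for each of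
    them.\<close>
  define C where "C = (\<Sum>x | m x \<noteq> 0. m x / \<pi> x)"
  have pos: "0 < \<pi> x" for x
    by (rule stationary_pos[OF \<pi>])
  have C: "m x \<le> C * \<pi> x" for x
  proof (cases "m x = 0")
    case True
    have "0 \<le> C"
      unfolding C_def by (intro sum_nonneg) (auto simp: prob_vec_nonneg m pos less_imp_le)
    then show ?thesis
      using True pos[of x] by simp
  next
    case False
    then have "m x / \<pi> x \<le> C"
      unfolding C_def using supp
      by (intro member_le_sum) (auto simp: prob_vec_nonneg m pos less_imp_le)
    then show ?thesis
      using pos[of x] by (simp add: field_simps)
  qed
  have sumC: "(\<lambda>x. C * \<pi> x) summable_on UNIV"
    by (intro summable_on_cmult_right prob_vec_summable \<pi>)
  have qC: "q k x \<le> C * \<pi> x" for k x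
  proof (induction k arbitrary: x)
    case (Suc k)
    have "push P (q k) x \<le> push P (\<lambda>x. C * \<pi> x) x"
      by (intro push_mono Suc.IH sumC prob_vec_nonneg q)
    also have "\<dots> = C * push P \<pi> x"
      by (simp add: push_def mult.assoc infsum_cmult_right')
    finally show ?case
      by (simp add: q_Suc \<pi>)
  qed (simp add: q_0 C)
  have tail_Suc: "tail (q k) y \<le> tail (q (Suc k)) y" for k y
  proof (induction k arbitrary: y)
    case (Suc k)
    then show ?case
      using push_tail_mono[OF q q Suc.IH] by (simp add: q_Suc)
  qed (simp add: q_0 q_Suc incr)
  have inc: "incseq (\<lambda>k. tail (q k) y)" for y
    using tail_Suc by (rule incseq_SucI)
  have tconv: "convergent (\<lambda>k. tail (q k) y)" for y
    using incseq_convergent[OF inc, of y 1] tail_le_1[OF q] by (metis convergent_def)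
  define t where "t y = lim (\<lambda>k. tail (q k) y)" for y
  have t: "(\<lambda>k. tail (q k) y) \<longlonglongrightarrow> t y" for y
    using tconv by (simp add: t_def convergent_LIMSEQ_iff)
  \<comment> \<open>Bounded increasing tails converge, and point masses are differences of
    consecutive tails, so the whole sequence \<open>q\<close> converges pointwise.\<close>
  define \<mu> where "\<mu> y = t y - t (Suc y)" for y
  have lim: "(\<lambda>k. q k y) \<longlonglongrightarrow> \<mu> y" for y
    unfolding \<mu>_def by (subst prob_vec_eq_tail_diff[OF q]) (intro tendsto_diff t)
  have abs_q: "\<bar>q k x\<bar> \<le> C * \<pi> x" for k x
    using qC prob_vec_nonneg[OF q] by simp
  have mass: "(\<lambda>k. \<Sum>\<^sub>\<infinity>x. q k x) \<longlonglongrightarrow> (\<Sum>\<^sub>\<infinity>x. \<mu> x)" and \<mu>s: "\<mu> summable_on UNIV"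
    by (rule infsum_tendsto_dominated[OF lim abs_q sumC])+
  have "(\<Sum>\<^sub>\<infinity>x. q k x) = 1" for k
    by (rule infsumI[OF prob_vec_has_sum[OF q]])
  then have "(\<Sum>\<^sub>\<infinity>x. \<mu> x) = 1"
    using mass by (simp add: LIMSEQ_const_iff)
  moreover have "0 \<le> \<mu> x" for x
    using lim by (rule LIMSEQ_le_const) (use prob_vec_nonneg[OF q] in auto)
  ultimately have \<mu>: "prob_vec \<mu>"
    using has_sum_infsum[OF \<mu>s] by (simp add: prob_vec_def)
  \<comment> \<open>The shifted sequence has both sides as limits: one by dominated convergence
    under \<open>C * \<pi> x\<close>, the other by the shift alone.\<close>
  have "push P \<mu> y = \<mu> y" for y
  proof (rule LIMSEQ_unique)
    show "(\<lambda>k. q (Suc k) y) \<longlonglongrightarrow> push P \<mu> y"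
      unfolding q_Suc push_def
    proof (rule infsum_tendsto_dominated(2))
      show "(\<lambda>k. q k x * P x y) \<longlonglongrightarrow> \<mu> x * P x y" for x
        by (intro tendsto_mult_right lim)
      show "\<bar>q k x * P x y\<bar> \<le> C * \<pi> x" for k x
        using abs_q[of k x] prob_vec_nonneg[OF row, of x y] prob_vec_le_1[OF row, of x y]
        by (metis abs_ge_zero abs_mult abs_of_nonneg mult_left_le order_trans)
    qed (rule sumC)
    show "(\<lambda>k. q (Suc k) y) \<longlonglongrightarrow> \<mu> y"
      using lim by (rule LIMSEQ_Suc)
  qed
  then have "push P \<mu> = \<mu>" ..
  then have "\<mu> = \<pi>"
    by (rule stationary_unique[OF \<mu> _ \<pi>])
  moreover have "(\<lambda>k. tail (q k) y) \<longlonglongrightarrow> tail \<mu> y"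
    unfolding tail_eq_1_minus[OF q] tail_eq_1_minus[OF \<mu>] by (intro tendsto_intros lim)
  moreover have "tail (q 0) y \<le> tail (q k) y" for k
    using inc by (simp add: incseq_def)
  ultimately show ?thesis
    using LIMSEQ_le_const by (metis q_0)
qed

text \<open>On \<open>{0..n}\<close> the vector \<open>\<nu>\<close> is reproduced by
  \<open>Q\<close>, which dominates \<open>P\<close> there. The bound in the second claim stops at
  \<open>n\<close>: beyond it \<open>\<nu>\<close> vanishes while \<open>push P \<nu>\<close> may
  not.\<close>

lemma augmentation_push_le:
  assumes aug: "general_augmentation {0..n} P Q"
    and \<nu>: "\<nu> \<in> stationary_distributions {0..n} Q"
  shows "prob_vec \<nu>" and "\<And>y. y \<le> n \<Longrightarrow> push P \<nu> y \<le> \<nu> y"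
    and "\<And>y. tail \<nu> y \<le> tail \<pi> y"
proof -
  have \<nu>0: "0 \<le> \<nu> x" and out: "n < x \<Longrightarrow> \<nu> x = 0" for x
    using \<nu> by (cases "x \<le> n"; simp add: stationary_distributions_def)+
  have "(\<nu> has_sum 1) {0..n}"
    using \<nu> by (simp add: stationary_distributions_def)
  then have "(\<nu> has_sum 1) UNIV"
    using has_sum_cong_neutral[of UNIV "{0..n}" \<nu> \<nu>] out by simp
  then show pv: "prob_vec \<nu>"
    by (simp add: prob_vec_def \<nu>0)
  show le: "push P \<nu> y \<le> \<nu> y" if "y \<le> n" for y
  proof -
    have "push P \<nu> y = (\<Sum>\<^sub>\<infinity>x\<in>{0..n}. \<nu> x * P x y)"
      unfolding push_def by (rule infsum_cong_neutral) (auto simp: out)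
    also have "\<dots> \<le> (\<Sum>\<^sub>\<infinity>x\<in>{0..n}. \<nu> x * Q x y)"
      using aug that by (intro infsum_mono mult_left_mono \<nu>0) (auto simp: general_augmentation_def)
    also have "\<dots> = \<nu> y"
      using \<nu> that by (intro infsumI) (auto simp: stationary_distributions_def)
    finally show ?thesis .
  qed
  show "tail \<nu> y \<le> tail \<pi> y" for y
  proof (rule tail_le_stationary[OF pv])
    show "finite {x. \<nu> x \<noteq> 0}"
    proof (rule finite_subset)
      show "{x. \<nu> x \<noteq> 0} \<subseteq> {..n}"
      proof
        show "x \<in> {..n}" if "x \<in> {x. \<nu> x \<noteq> 0}" for x
          using that out[of x] by (cases "n < x") auto
      qed
    qed simp
    \<comment> \<open>For \<open>y \<le> n\<close> the step by \<open>P\<close> can only decrease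
      the mass below \<open>y\<close>; for larger \<open>y\<close> the left side is 0.\<close>
    show "tail \<nu> y \<le> tail (push P \<nu>) y" for y
    proof (cases "y \<le> n")
      case True
      then show ?thesis
        unfolding tail_eq_1_minus[OF pv] tail_eq_1_minus[OF push_prob_vec[OF pv]]
        by (intro diff_left_mono sum_mono le) simp
    next
      case False
      then have "tail \<nu> y = 0"
        unfolding tail_def by (intro infsum_0) (auto simp: out)
      then show ?thesis
        by (simp add: tail_nonneg push_prob_vec pv)
    qed
  qed
qed

section \<open>Convergence of tight subinvariant sequences\<close>

text \<open>The uniform tail bound keeps all mass in the limit, and subinvariance survives it, so
  equal masses and uniqueness identify \<open>\<mu>\<close>. Subinvariance is required only
  eventually for each \<open>y\<close>, as the truncations provide it only up to their size.\<close>

lemma tight_limit_eq_stationary: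
  assumes \<nu>: "\<And>n. prob_vec (\<nu> n)" and tight: "\<And>n y. tail (\<nu> n) y \<le> tail \<pi> y"
    and sub: "\<And>y. \<forall>\<^sub>F n in sequentially. push P (\<nu> n) y \<le> \<nu> n y"
    and lim: "\<And>x. (\<lambda>n. \<nu> n x) \<longlonglongrightarrow> \<mu> x"
  shows "\<mu> = \<pi>"
proof -
  have \<mu>0: "0 \<le> \<mu> x" for x
    using lim by (rule LIMSEQ_le_const) (use prob_vec_nonneg[OF \<nu>] in auto)
  have sumlim: "(\<lambda>n. \<Sum>w<y. \<nu> n w) \<longlonglongrightarrow> (\<Sum>w<y. \<mu> w)" for y
    by (intro tendsto_sum lim)
  have "(\<Sum>w<y. \<mu> w) \<le> 1" for y
    using sumlim by (rule LIMSEQ_le_const2)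
      (metis \<nu> diff_ge_0_iff_ge tail_eq_1_minus tail_nonneg)
  moreover have "1 - tail \<pi> y \<le> (\<Sum>w<y. \<mu> w)" for y
    using sumlim
  proof (rule LIMSEQ_le_const)
    show "\<exists>N. \<forall>n\<ge>N. 1 - tail \<pi> y \<le> (\<Sum>w<y. \<nu> n w)"
      using tight[of _ y] by (simp add: tail_eq_1_minus[OF \<nu>] algebra_simps)
  qed
  moreover have "(\<lambda>y. 1 - tail \<pi> y) \<longlonglongrightarrow> 1"
    using tendsto_diff[OF tendsto_const tail_tendsto_0[OF \<pi>(1)], of 1] by simp
  ultimately have "\<mu> sums 1"
    unfolding sums_def
    by - (rule real_tendsto_sandwich[where f = "\<lambda>y. 1 - tail \<pi> y" and h = "\<lambda>_. 1"], auto)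
  then have \<mu>: "prob_vec \<mu>"
    using sums_nonneg_imp_has_sum[of \<mu> 1] \<mu>0 by (simp add: prob_vec_def)
  \<comment> \<open>Fatou's lemma by hand: finite partial sums pass to the limit, and each is
    bounded by \<open>\<mu> y\<close>.\<close>
  have "push P \<mu> y \<le> \<mu> y" for y
    unfolding push_def
  proof (rule infsum_le_finite_sums)
    show "(\<lambda>x. \<mu> x * P x y) summable_on UNIV"
      by (intro push_has_sum(2) \<mu>0 prob_vec_summable \<mu>)
    fix F :: "nat set" assume F: "finite F"
    have le: "(\<Sum>x\<in>F. \<nu> n x * P x y) \<le> push P (\<nu> n) y" for n
      unfolding push_def using F
      by (intro finite_sum_le_infsum push_has_sum(2))
        (auto simp: prob_vec_nonneg \<nu> row prob_vec_summable)
    show "(\<Sum>x\<in>F. \<mu> x * P x y) \<le> \<mu> y"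
    proof (rule tendsto_le[OF _ lim])
      show "(\<lambda>n. \<Sum>x\<in>F. \<nu> n x * P x y) \<longlonglongrightarrow> (\<Sum>x\<in>F. \<mu> x * P x y)"
        by (intro tendsto_intros lim)
      show "\<forall>\<^sub>F n in sequentially. (\<Sum>x\<in>F. \<nu> n x * P x y) \<le> \<nu> n y"
        using sub[of y] by eventually_elim (use le order_trans in blast)
    qed simp
  qed
  then have "push P \<mu> = \<mu>"
    by (rule prob_vec_le_imp_eq[OF push_prob_vec[OF \<mu>] \<mu>])
  then show ?thesis
    by (rule stationary_unique[OF \<mu> _ \<pi>])
qed

text \<open>Subsequence argument: indices staying \<open>e\<close> away from the limit would contain
  a further subsequence converging to \<pi>.\<close>

lemma tight_tendsto_stationary:
  assumes \<nu>: "\<And>n. prob_vec (\<nu> n)" and tight: "\<And>n y. tail (\<nu> n) y \<le> tail \<pi> y"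
    and sub: "\<And>y. \<forall>\<^sub>F n in sequentially. push P (\<nu> n) y \<le> \<nu> n y"
  shows "(\<lambda>n. \<nu> n x) \<longlonglongrightarrow> \<pi> x"
proof (rule ccontr)
  assume "\<not> (\<lambda>n. \<nu> n x) \<longlonglongrightarrow> \<pi> x"
  then obtain e where "0 < e" and e: "\<And>N. \<exists>n\<ge>N. e \<le> dist (\<nu> n x) (\<pi> x)"
    by (auto simp: lim_sequentially not_less)
  then have "infinite {n. e \<le> dist (\<nu> n x) (\<pi> x)}"
    unfolding infinite_nat_iff_unbounded_le by simp
  then obtain s :: "nat \<Rightarrow> nat" where s: "strict_mono s" "\<And>n. e \<le> dist (\<nu> (s n) x) (\<pi> x)"
    using infinite_enumerate[of "{n. e \<le> dist (\<nu> n x) (\<pi> x)}"] by auto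
  obtain r \<mu> where r: "strict_mono r" and lim: "\<And>x. (\<lambda>n. \<nu> (s (r n)) x) \<longlonglongrightarrow> \<mu> x"
    by (rule prob_vec_subseq_tendsto[of "\<lambda>n. \<nu> (s n)", OF \<nu>]) (rule that)
  have sr: "filterlim (\<lambda>n. s (r n)) sequentially sequentially"
    using filterlim_subseq[OF strict_mono_o[OF s(1) r]] by (simp add: o_def)
  have "\<mu> = \<pi>"
  proof (rule tight_limit_eq_stationary[of "\<lambda>n. \<nu> (s (r n))"])
    show "\<forall>\<^sub>F n in sequentially. push P (\<nu> (s (r n))) y \<le> \<nu> (s (r n)) y" for y
      by (rule eventually_compose_filterlim[OF sub sr])
  qed (fact \<nu> tight lim)+
  then have "(\<lambda>n. \<nu> (s (r n)) x) \<longlonglongrightarrow> \<pi> x"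
    using lim[of x] by simp
  then obtain n where "dist (\<nu> (s (r n)) x) (\<pi> x) < e"
    using metric_LIMSEQ_D[OF _ \<open>0 < e\<close>] by blast
  then show False
    using s(2)[of "r n"] by linarith
qed

end

section \<open>Scheffe's lemma and the conclusion\<close>

text \<open>The deficit \<open>max 0 (p x - q n x)\<close> is dominated by \<open>p\<close>, so its
  sum vanishes in the limit. Since \<open>q n - p\<close> has total 0, the absolute differences sum
  to twice the deficit.\<close>

lemma scheffe:
  fixes q :: "nat \<Rightarrow> nat \<Rightarrow> real"
  assumes q: "\<And>n. prob_vec (q n)" and p: "prob_vec p" and lim: "\<And>x. (\<lambda>n. q n x) \<longlonglongrightarrow> p x"
  shows "(\<lambda>n. \<Sum>\<^sub>\<infinity>x. \<bar>q n x - p x\<bar>) \<longlonglongrightarrow> 0"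
proof -
  define d where "d n x = max 0 (p x - q n x)" for n x
  have d: "\<bar>d n x\<bar> \<le> p x" for n x
    using prob_vec_nonneg[OF q, of n x] prob_vec_nonneg[OF p, of x] by (simp add: d_def)
  have ds: "d n summable_on UNIV" for n
    by (rule summable_on_comparison_test[OF prob_vec_summable[OF p]])
      (use d in \<open>auto simp: d_def intro: order_trans[OF abs_ge_self]\<close>)
  have "(\<lambda>n. d n x) \<longlonglongrightarrow> 0" for x
    using tendsto_max[OF tendsto_const[of 0] tendsto_diff[OF tendsto_const[of "p x"] lim[of x]]]
    by (simp add: d_def)
  then have "(\<lambda>n. \<Sum>\<^sub>\<infinity>x. d n x) \<longlonglongrightarrow> (\<Sum>\<^sub>\<infinity>x::nat. 0)"
    using d prob_vec_summable[OF p] by (rule infsum_tendsto_dominated(2))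
  then have "(\<lambda>n. 2 * (\<Sum>\<^sub>\<infinity>x. d n x)) \<longlonglongrightarrow> 0"
    using tendsto_mult_right_zero by fastforce
  moreover have "(\<Sum>\<^sub>\<infinity>x. \<bar>q n x - p x\<bar>) = 2 * (\<Sum>\<^sub>\<infinity>x. d n x)" for n
  proof -
    have "((\<lambda>x. 2 * d n x + (q n x - p x)) has_sum (2 * (\<Sum>\<^sub>\<infinity>x. d n x) + (1 - 1))) UNIV"
      by (intro has_sum_add has_sum_diff has_sum_cmult_right has_sum_infsum ds
          prob_vec_has_sum q p)
    moreover have "2 * d n x + (q n x - p x) = \<bar>q n x - p x\<bar>" for x
      by (simp add: d_def max_def)
    ultimately show ?thesis
      by (simp add: infsumI)
  qed
  ultimately show ?thesis
    by simp
qed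

theorem theorem2:
  fixes P :: "nat \<Rightarrow> nat \<Rightarrow> real"
    and Pr :: "nat \<Rightarrow> 'w measure"
    and X :: "nat \<Rightarrow> 'w \<Rightarrow> nat"
    and \<pi> :: "nat \<Rightarrow> real"
    and Pn :: "nat \<Rightarrow> nat \<Rightarrow> nat \<Rightarrow> real"
    and \<pi>n :: "nat \<Rightarrow> nat \<Rightarrow> real"
  assumes "markov_chain P Pr X"
    and "irreducible_matrix P"
    and "positive_recurrent Pr X"
    and "\<pi> \<in> stationary_distributions UNIV P"
    and "stochastically_monotone P"
    and "\<And>n. n \<ge> 1 \<Longrightarrow> general_augmentation {0..n} P (Pn n)"
    and "\<And>n. n \<ge> 1 \<Longrightarrow> \<pi>n n \<in> stationary_distributions {0..n} (Pn n)"
  shows "(\<lambda>n. \<Sum>\<^sub>\<infinity>x. \<bar>\<pi>n n x - \<pi> x\<bar>) \<longlonglongrightarrow> 0"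
proof -
  interpret stochastic_kernel P
    using assms(1) by unfold_locales (simp add: markov_chain_def)
  have \<pi>: "prob_vec \<pi>" "push P \<pi> = \<pi>"
    using assms(4) by (auto simp: stationary_iff)
  interpret monotone_kernel P \<pi>
    by unfold_locales (fact assms \<pi>)+
  \<comment> \<open>The hypotheses start at index 1, so the argument runs along
    \<open>Suc n\<close>; the shift is undone at the end.\<close>
  have aug: "general_augmentation {0..Suc n} P (Pn (Suc n))"
    and stat: "\<pi>n (Suc n) \<in> stationary_distributions {0..Suc n} (Pn (Suc n))" for n
    using assms(6,7) by simp_all
  note facts = augmentation_push_le[OF aug stat]
  have "(\<lambda>n. \<pi>n (Suc n) x) \<longlonglongrightarrow> \<pi> x" for x
  proof (rule tight_tendsto_stationary[OF facts(1,3)])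
    show "\<forall>\<^sub>F n in sequentially. push P (\<pi>n (Suc n)) y \<le> \<pi>n (Suc n) y" for y
      using eventually_ge_at_top[of y] by eventually_elim (simp add: facts(2))
  qed
  then have "(\<lambda>n. \<Sum>\<^sub>\<infinity>x. \<bar>\<pi>n (Suc n) x - \<pi> x\<bar>) \<longlonglongrightarrow> 0"
    by (rule scheffe[OF facts(1) \<pi>(1)])
  then show ?thesis
    by (rule LIMSEQ_imp_Suc)
qed

end
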